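(* Let $A$ and $D$ be real symmetric and semi-positive definite $N\times N$ matrices with constant elements, let $p\geqslant 1$ and let $C_p$ be the $(N-p)\times N$ matrix of synchronization by $p$-groups defined in the context. Assume that the system $$U''+\mathcal LU+AU+D\mathcal GU'=0$$ is uniformly synchronizable by $p$-groups and that $$\operatorname{rank}(D)=\operatorname{rank}(C_pD)=N-p.$$ Then $A$ satisfies the condition of $C_p$-compatibility $$A\operatorname{Ker}(C_p)\subseteq\operatorname{Ker}(C_p),$$ and $D$ satisfies the condition of strong $C_p$-compatibility $$\operatorname{Ker}(C_p)\subseteq\operatorname{Ker}(D).$$
   Context: $H\neq\{0\}$ and $V$ are real Hilbert spaces with $V\subset H\subset V'$, where $V'$ is the dual of $V$, $H$ is identified with its dual, and the embeddings are dense and compact. $L:V\to V'$ is the duality mapping, $\langle Lu,\phi\rangle_{V',V}=(u,\phi)_V$. $g:V\to V'$ is a linear continuous symmetric operator with $\langle gv,v\rangle_{V',V}\geqslant 0$ for all $v\in V$. With $I$ the identity of $\mathbb R^N$, $\mathcal L=LI$ and $\mathcal G=gI$ act componentwise on $V^N$; matrices act on the $\mathbb R^N$-index. The solution with initial data $(U_0,U_1)\in(V\times H)^N$ is the weak (mild) solution $U\in C^0(\mathbb R^+,V^N)\cap C^1(\mathbb R^+,H^N)$ given by the $C_0$-semigroup on $(V\times H)^N$ whose generator is $(U,Z)\mapsto (Z,-\mathcal LU-AU-D\mathcal GZ)$ with domain $\{(U,Z)\in V^N\times V^N:\ \mathcal LU+AU+D\mathcal GZ\in H^N\}$. Groups: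 integers $0=n_0<n_1<\dots<n_p=N$ with $n_r-n_{r-1}\geqslant 2$ for $1\leqslant r\leqslant p$ are fixed. $S_r$ is the $(n_r-n_{r-1}-1)\times(n_r-n_{r-1})$ matrix whose $i$-th row has $1$ in column $i$, $-1$ in column $i+1$, and $0$ elsewhere; $C_p=\operatorname{diag}(S_1,\dots,S_p)$ (block diagonal), of order $(N-p)\times N$. Uniform synchronizability by $p$-groups: there exist constants $M\geqslant 1$, $\omega>0$ such that for every $(U_0,U_1)\in(V\times H)^N$ the corresponding solution satisfies $$\|C_p(U(t),U'(t))\|_{(V\times H)^{N-p}}\leqslant Me^{-\omega t}\|C_p(U_0,U_1)\|_{(V\times H)^{N-p}},\quad t\geqslant 0,$$ where $C_p(U,U')=(C_pU,C_pU')$. *)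

theory Defs
  imports "HOL-Analysis.Analysis"
begin

text \<open>
  Conventions. An inclusion of Hilbert spaces \<open>V \<subset> H\<close> is an explicit map \<open>J\<close> from the type
  of \<open>V\<close> to the type of \<open>H\<close>. The dual \<open>V'\<close> is the type of bounded linear functionals on \<open>V\<close>.
  The number \<open>N\<close> is \<open>CARD('n)\<close>; the index type is linearly ordered, so that its elements
  correspond to \<open>1, \<dots>, N\<close>.
\<close>

section \<open>The triple of Hilbert spaces\<close>

definition dense_compact_embedding ::
    "('a::real_normed_vector \<Rightarrow> 'b::real_normed_vector) \<Rightarrow> bool" where
  "dense_compact_embedding f \<longleftrightarrow>
     bounded_linear f \<and> inj f \<and> closure (range f) = UNIV \<and>
     (\<forall>B. bounded B \<longrightarrow> compact (closure (f ` B)))"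

text \<open>The embedding \<open>H \<subset> V'\<close> obtained by identifying \<open>H\<close> with its dual:
  \<open>h\<close> acts on \<open>V\<close> by \<open>v \<mapsto> (h, J v)\<^sub>H\<close>, a bounded functional as \<open>J\<close> is bounded.\<close>

definition pivot :: "('v::real_inner \<Rightarrow> 'h::real_inner) \<Rightarrow> 'h \<Rightarrow> ('v \<Rightarrow>\<^sub>L real)" where
  "pivot J h = Blinfun (\<lambda>v. h \<bullet> J v)"

definition hilbert_triple :: "('v::real_inner \<Rightarrow> 'h::real_inner) \<Rightarrow> bool" where
  "hilbert_triple J \<longleftrightarrow> dense_compact_embedding J \<and> dense_compact_embedding (pivot J)"

definition duality_map :: "'v::real_inner \<Rightarrow> ('v \<Rightarrow>\<^sub>L real)" where
  "duality_map u = Blinfun (\<lambda>\<phi>. u \<bullet> \<phi>)"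

definition symmetric_nonneg_operator :: "('v::real_inner \<Rightarrow> ('v \<Rightarrow>\<^sub>L real)) \<Rightarrow> bool" where
  "symmetric_nonneg_operator g \<longleftrightarrow>
     bounded_linear g \<and>
     (\<forall>u v. blinfun_apply (g u) v = blinfun_apply (g v) u) \<and>
     (\<forall>v. 0 \<le> blinfun_apply (g v) v)"

section \<open>Matrices and componentwise operators\<close>

definition componentwise :: "('a \<Rightarrow> 'b) \<Rightarrow> 'a^'n \<Rightarrow> 'b^'n" where
  "componentwise f x = (\<chi> i. f (x $ i))"

definition mat_act :: "real^'n^'m \<Rightarrow> 'a::real_vector^'n \<Rightarrow> 'a^'m" where
  "mat_act M x = (\<chi> i. \<Sum>j\<in>UNIV. M $ i $ j *\<^sub>R x $ j)"

definition symmetric_psd :: "real^'n^'n \<Rightarrow> bool" where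
  "symmetric_psd M \<longleftrightarrow> transpose M = M \<and> (\<forall>x. 0 \<le> x \<bullet> (M *v x))"

definition Ker :: "real^'n^'m \<Rightarrow> (real^'n) set" where
  "Ker M = {x. M *v x = 0}"

section \<open>Groups and the synchronization matrix\<close>

definition grouping :: "(nat \<Rightarrow> nat) \<Rightarrow> nat \<Rightarrow> nat \<Rightarrow> bool" where
  "grouping n p N \<longleftrightarrow> n 0 = 0 \<and> n p = N \<and> (\<forall>r\<in>{1..p}. n (r - 1) + 2 \<le> n r)"

text \<open>Entries of the matrices \<open>S\<^sub>r\<close>, with rows and columns numbered from \<open>1\<close>; they depend on
  \<open>r\<close> only through the size of the matrix.\<close>

definition S_entry :: "nat \<Rightarrow> nat \<Rightarrow> real" where
  "S_entry i j = (if j = i then 1 else if j = i + 1 then - 1 else 0)"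

text \<open>Total number of rows of \<open>S\<^sub>1, \<dots>, S\<^sub>r\<close>; the total number of columns is \<open>n r\<close>.\<close>

definition row_offset :: "(nat \<Rightarrow> nat) \<Rightarrow> nat \<Rightarrow> nat" where
  "row_offset n r = (\<Sum>s = 1..r. n s - n (s - 1) - 1)"

text \<open>Entries of \<open>diag(S\<^sub>1, \<dots>, S\<^sub>p)\<close>, numbered from \<open>1\<close>. At most one summand is nonzero, the one
  whose block contains both row \<open>k\<close> and column \<open>l\<close>.\<close>

definition sync_entry :: "(nat \<Rightarrow> nat) \<Rightarrow> nat \<Rightarrow> nat \<Rightarrow> nat \<Rightarrow> real" where
  "sync_entry n p k l =
     (\<Sum>r = 1..p.
        if k \<in> {row_offset n (r - 1) <.. row_offset n r} \<and> l \<in> {n (r - 1) <.. n r}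
        then S_entry (k - row_offset n (r - 1)) (l - n (r - 1)) else 0)"

text \<open>The number in \<open>{1..CARD('n)}\<close> of an element of a finite linearly ordered type.\<close>

definition position :: "'n::{finite,linorder} \<Rightarrow> nat" where
  "position i = card {j. j \<le> i}"

text \<open>This is the matrix \<open>C\<^sub>p\<close> provided that \<open>CARD('m) = CARD('n) - p\<close>.\<close>

definition sync_matrix ::
    "(nat \<Rightarrow> nat) \<Rightarrow> nat \<Rightarrow> real^('n::{finite,linorder})^('m::{finite,linorder})" where
  "sync_matrix n p = (\<chi> k l. sync_entry n p (position k) (position l))"

section \<open>Semigroups and solutions\<close>

definition c0_semigroup :: "(real \<Rightarrow> 'a::real_normed_vector \<Rightarrow> 'a) \<Rightarrow> bool" where
  "c0_semigroup T \<longleftrightarrow>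
     (\<forall>t\<ge>0. bounded_linear (T t)) \<and>
     (\<forall>x. T 0 x = x) \<and>
     (\<forall>s\<ge>0. \<forall>t\<ge>0. \<forall>x. T (s + t) x = T s (T t x)) \<and>
     (\<forall>x. ((\<lambda>t. T t x) \<longlongrightarrow> x) (at_right 0))"

text \<open>Unbounded operators are given by their graphs.\<close>

definition generator :: "(real \<Rightarrow> 'a::real_normed_vector \<Rightarrow> 'a) \<Rightarrow> ('a \<times> 'a) set" where
  "generator T = {(x, y). ((\<lambda>t. (1 / t) *\<^sub>R (T t x - x)) \<longlongrightarrow> y) (at_right 0)}"

text \<open>
  Graph of \<open>(U, Z) \<mapsto> (Z, - LU - AU - DGZ)\<close>. The state space \<open>(V \<times> H)\<^sup>N\<close> is arranged as
  \<open>V\<^sup>N \<times> H\<^sup>N\<close>, which carries the same norm, so the state belonging to \<open>Z \<in> V\<^sup>N\<close> contains the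
  image of \<open>Z\<close> in \<open>H\<^sup>N\<close>. That \<open>LU + AU + DGZ\<close> lies in \<open>H\<^sup>N\<close> is expressed by the existence of
  \<open>W\<close>; the equation for \<open>W\<close> is one in \<open>(V')\<^sup>N\<close>.
\<close>

definition wave_operator ::
    "('v::real_inner \<Rightarrow> 'h::real_inner) \<Rightarrow> ('v \<Rightarrow> ('v \<Rightarrow>\<^sub>L real)) \<Rightarrow> real^'n^'n \<Rightarrow> real^'n^'n
     \<Rightarrow> ((('v^'n) \<times> ('h^'n)) \<times> (('v^'n) \<times> ('h^'n))) set" where
  "wave_operator J g A D =
     {((U, componentwise J Z), (Z, W)) | U Z W.
        componentwise (pivot J) W =
          - componentwise duality_map U
          - componentwise (pivot J) (componentwise J (mat_act A U))
          - mat_act D (componentwise g Z)}"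

text \<open>
  \<open>U\<close> is the mild solution of \<open>U'' + LU + AU + DGU' = 0\<close> with data \<open>(U0, U1)\<close>, and \<open>U'\<close> is its
  time derivative in \<open>H\<^sup>N\<close>.
\<close>

definition mild_solution ::
    "('v::real_inner \<Rightarrow> 'h::real_inner) \<Rightarrow> ('v \<Rightarrow> ('v \<Rightarrow>\<^sub>L real)) \<Rightarrow> real^'n^'n \<Rightarrow> real^'n^'n
     \<Rightarrow> 'v^'n \<Rightarrow> 'h^'n \<Rightarrow> (real \<Rightarrow> 'v^'n) \<Rightarrow> (real \<Rightarrow> 'h^'n) \<Rightarrow> bool" where
  "mild_solution J g A D U0 U1 U U' \<longleftrightarrow>
     continuous_on {0..} U \<and> continuous_on {0..} U' \<and>
     (\<forall>t\<ge>0. ((\<lambda>s. componentwise J (U s)) has_vector_derivative U' t) (at t within {0..})) \<and>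
     (\<exists>T. c0_semigroup T \<and> generator T = wave_operator J g A D \<and>
          (\<forall>t\<ge>0. (U t, U' t) = T t (U0, U1)))"

text \<open>
  A \<open>C\<^sub>0\<close>-semigroup is determined by its generator, so the mild solution for given data is unique
  on \<open>{0..}\<close>, and \<open>\<exists>U U'\<close> below refers to that solution.
\<close>

definition uniformly_synchronizable ::
    "('v::real_inner \<Rightarrow> 'h::real_inner) \<Rightarrow> ('v \<Rightarrow> ('v \<Rightarrow>\<^sub>L real)) \<Rightarrow> real^'n^'n \<Rightarrow> real^'n^'n
     \<Rightarrow> real^'n^'m \<Rightarrow> bool" where
  "uniformly_synchronizable J g A D C \<longleftrightarrow>
     (\<exists>M\<ge>1. \<exists>\<omega>>0. \<forall>U0 U1. \<exists>U U'. mild_solution J g A D U0 U1 U U' \<and>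
        (\<forall>t\<ge>0. norm (mat_act C (U t), mat_act C (U' t))
               \<le> M * exp (- \<omega> * t) * norm (mat_act C U0, mat_act C U1)))"

end

theory Submission
  imports Defs
begin

text \<open>
  The synchronization estimate makes the states with values in \<open>Ker C\<close> invariant. Differentiating
  such a solution at time zero gives \<open>C A e = 0\<close> for \<open>e\<close> in \<open>Ker C\<close>. Then \<open>C D G (U t - U 0) = 0\<close> in
  the time-integrated equation, and the rank condition removes \<open>C\<close>. So \<open>U\<close> is undamped and, by
  conservation of energy, its primitive \<open>P\<close> is bounded; but \<open>D G (P t) = t D G (U 0)\<close>, hence
  \<open>D e \<otimes> g u = 0\<close> for all \<open>u\<close>. If \<open>g\<close> is nonzero, this is \<open>D e = 0\<close>. The case \<open>g = 0\<close> cannot occur,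
  since the conservative system has no decaying components.
\<close>

section \<open>Riesz representation and antiderivatives\<close>

text \<open>The quadratic is minimal at \<open>t = 0\<close>, so its slope \<open>2 * b\<close>
  there vanishes. This is the first-order condition in both variational arguments below.\<close>

lemma linear_coeff_zero_if_quadratic_nonneg:
  fixes b c :: real
  assumes "\<And>t. 0 \<le> 2 * t * b + t\<^sup>2 * c"
  shows "b = 0"
proof (rule ccontr)
  assume "b \<noteq> 0"
  \<comment> \<open>The choice \<open>t = - b / k\<close> gives the value
    \<open>b\<^sup>2 * (c - 2 * k) / k\<^sup>2\<close>, which is negative as soon as
    \<open>c < 2 * k\<close>.\<close>
  define k where "k = \<bar>c\<bar> + 1"
  have k: "k > 0" "c < 2 * k"
    by (auto simp: k_def)
  have "2 * (- b / k) * b + (- b / k)\<^sup>2 * c = (b\<^sup>2 / k\<^sup>2) * (c - 2 * k)"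
    using k by (simp add: power2_eq_square field_simps)
  moreover have "(b\<^sup>2 / k\<^sup>2) * (c - 2 * k) < 0"
    using k \<open>b \<noteq> 0\<close> by (intro mult_pos_neg) auto
  ultimately show False
    using assms[of "- b / k"] by linarith
qed

section \<open>Duality map and its bounded inverse\<close>

lemma duality_map_apply [simp]: "blinfun_apply (duality_map u) v = u \<bullet> v"
  unfolding duality_map_def
  by (simp add: bounded_linear_Blinfun_apply bounded_linear_inner_right)

lemma bounded_linear_duality_map: "bounded_linear duality_map"
proof (rule bounded_linear_intro[where K = 1])
  show "norm (duality_map x) \<le> norm x * 1" for x :: 'a
    by (rule norm_blinfun_bound) (use Cauchy_Schwarz_ineq2 in auto)
qed (auto intro!: blinfun_eqI simp: inner_add_left blinfun.bilinear_simps)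

lemmas linear_duality_map = bounded_linear.linear[OF bounded_linear_duality_map]

text \<open>Evaluate the functional at \<open>u\<close> itself. The bound yields injectivity and,
  later, the norm estimate for the inverse.\<close>

lemma norm_le_norm_duality_map: "norm u \<le> norm (duality_map u)"
proof (cases "u = 0")
  case False
  have "norm u * norm u \<le> norm (duality_map u) * norm u"
    using norm_blinfun[of "duality_map u" u]
    by (simp add: power2_norm_eq_inner flip: power2_eq_square)
  with False show ?thesis
    by simp
qed simp

lemma inj_duality_map: "inj duality_map"
proof (rule injI)
  fix x y :: 'a
  assume "duality_map x = duality_map y"
  then show "x = y"
    using norm_le_norm_duality_map[of "x - y"]
    by (simp add: linear_diff[OF linear_duality_map])
qed

text \<open>The representing vector minimizes \<open>|u|\<^sup>2 - 2 f u\<close>; minimizing sequences are Cauchy by the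
  parallelogram identity.\<close>

theorem riesz_representation:
  fixes f :: "'a::{real_inner,complete_space} \<Rightarrow>\<^sub>L real"
  obtains u where "duality_map u = f"
proof -
  define q where "q u = u \<bullet> u - 2 * f u" for u
  have lower: "- (norm f)\<^sup>2 \<le> q u" for u
  proof -
    have "f u \<le> norm f * norm u"
      using norm_blinfun[of f u] by simp
    moreover have "0 \<le> (norm u - norm f)\<^sup>2"
      by simp
    ultimately show ?thesis
      unfolding q_def power2_norm_eq_inner[symmetric]
      by (simp add: power2_eq_square algebra_simps)
  qed
  define m where "m = Inf (range q)"
  have bdd: "bdd_below (range q)"
    using lower by (intro bdd_belowI[of _ "- (norm f)\<^sup>2"]) auto
  have m_le: "m \<le> q u" for u
    unfolding m_def by (intro cInf_lower bdd) auto
  have "\<exists>u. q u < m + 1 / Suc k" for k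
    using cInf_lessD[of "range q" "m + 1 / Suc k"] by (auto simp: m_def)
  then obtain x where x: "\<And>k. q (x k) < m + 1 / Suc k"
    by metis
  \<comment> \<open>The linear parts cancel because \<open>f u + f v\<close> is twice the value of
    \<open>f\<close> at the midpoint; what remains is the parallelogram identity.\<close>
  have par: "(norm (u - v))\<^sup>2 = 2 * q u + 2 * q v - 4 * q ((1/2) *\<^sub>R (u + v))" for u v
    unfolding power2_norm_eq_inner q_def
    by (simp add: inner_simps blinfun.bilinear_simps inner_commute algebra_simps)
  have dist_x: "(dist (x k) (x l))\<^sup>2 \<le> 2 / Suc k + 2 / Suc l" for k l
    using par[of "x k" "x l"] x[of k] x[of l] m_le[of "(1/2) *\<^sub>R (x k + x l)"]
    by (simp add: dist_norm)
  have "Cauchy x"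
  proof (rule metric_CauchyI)
    fix e :: real
    assume "e > 0"
    then obtain K where K: "1 / real (Suc K) < e\<^sup>2 / 4"
      using nat_approx_posE[of "e\<^sup>2 / 4"] by auto
    have "dist (x k) (x l) < e" if "k \<ge> K" "l \<ge> K" for k l
    proof -
      have "2 / real (Suc k) \<le> 2 / Suc K" "2 / real (Suc l) \<le> 2 / Suc K"
        using that by (auto simp: frac_le)
      moreover have "4 / Suc K < e\<^sup>2"
        using mult_strict_left_mono[OF K, of 4] by simp
      ultimately have "(dist (x k) (x l))\<^sup>2 < e\<^sup>2"
        using dist_x[of k l] by linarith
      with \<open>e > 0\<close> show ?thesis
        by (simp add: power_less_imp_less_base)
    qed
    then show "\<exists>M. \<forall>k\<ge>M. \<forall>l\<ge>M. dist (x k) (x l) < e"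
      by blast
  qed
  then obtain u where u: "x \<longlonglongrightarrow> u"
    by (auto simp: Cauchy_convergent_iff convergent_def)
  have "(\<lambda>k. q (x k)) \<longlonglongrightarrow> q u"
    unfolding q_def by (intro tendsto_intros u)
  moreover have "(\<lambda>k. m + 1 / Suc k) \<longlonglongrightarrow> m + 0"
    by (intro tendsto_intros LIMSEQ_Suc[OF lim_1_over_n])
  ultimately have "q u \<le> m"
    using x by (intro LIMSEQ_le[where X = "\<lambda>k. q (x k)"]) (auto intro: less_imp_le)
  have "f \<phi> = u \<bullet> \<phi>" for \<phi>
  proof -
    \<comment> \<open>The right-hand side is \<open>q (u + t *\<^sub>R \<phi>) - q u\<close>, and
      \<open>u\<close> is a minimizer.\<close>
    have "0 \<le> 2 * t * (u \<bullet> \<phi> - f \<phi>) + t\<^sup>2 * (\<phi> \<bullet> \<phi>)" for t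
      using m_le[of "u + t *\<^sub>R \<phi>"] \<open>q u \<le> m\<close>
      by (simp add: q_def inner_simps blinfun.bilinear_simps inner_commute algebra_simps
          power2_eq_square)
    from linear_coeff_zero_if_quadratic_nonneg[OF this] show ?thesis
      by simp
  qed
  then have "duality_map u = f"
    by (intro blinfun_eqI) simp
  then show thesis
    by (rule that)
qed

lemma bounded_linear_inv_duality_map:
  "bounded_linear (inv (duality_map :: 'a::{real_inner,complete_space} \<Rightarrow> _))"
proof -
  interpret bounded_linear "duality_map :: 'a \<Rightarrow> _"
    by (rule bounded_linear_duality_map)
  have surj: "surj (duality_map :: 'a \<Rightarrow> _)"
    unfolding surj_def by (metis riesz_representation)
  have inv: "inv duality_map f = u \<longleftrightarrow> f = duality_map u" for f and u :: 'a
    using surj by (metis inj_duality_map inv_f_f surj_f_inv_f)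
  show ?thesis
  proof (rule bounded_linear_intro[where K = 1])
    show "norm (inv duality_map f :: 'a) \<le> norm f * 1" for f
      using norm_le_norm_duality_map[of "inv duality_map f :: 'a"] surj by (simp add: surj_f_inv_f)
  qed (use surj in \<open>simp_all add: inv add scaleR surj_f_inv_f\<close>)
qed

text \<open>The integral is taken in the dual space, because the sort \<open>{real_inner, complete_space}\<close>
  is not contained in the class \<open>banach\<close> required by the integration library.\<close>

lemma continuous_on_imp_antiderivative:
  fixes f :: "real \<Rightarrow> 'a::{real_inner,complete_space}"
  assumes "continuous_on {0..} f"
  obtains F where "F 0 = 0" "\<And>t. t \<ge> 0 \<Longrightarrow> (F has_vector_derivative f t) (at t within {0..})"
proof -
  interpret I: bounded_linear "inv (duality_map :: 'a \<Rightarrow> _)"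
    by (rule bounded_linear_inv_duality_map)
  define G where "G t = integral {0..t} (\<lambda>s. duality_map (f s))" for t
  have "(G has_vector_derivative duality_map (f t)) (at t within {0..})" if "t \<ge> 0" for t
  proof -
    \<comment> \<open>The compact interval extends beyond \<open>t\<close>, so derivatives at
      \<open>t\<close> within it and within the half line agree.\<close>
    have "continuous_on {0..t+1} (\<lambda>s. duality_map (f s))"
      by (intro bounded_linear.continuous_on[OF bounded_linear_duality_map]
          continuous_on_subset[OF assms]) auto
    then have "(G has_vector_derivative duality_map (f t)) (at t within {0..t+1})"
      unfolding G_def using that by (intro integral_has_vector_derivative) auto
    moreover have "at t within {0..t+1} = at t within {0..}"
      using that by (intro at_within_nhd[where S = "{..<t+1}"]) auto
    ultimately show ?thesis
      by simp
  qed
  then have "((\<lambda>t. inv duality_map (G t)) has_vector_derivative f t) (at t within {0..})"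
    if "t \<ge> 0" for t
    using I.has_vector_derivative[of G "duality_map (f t)"] that by (simp add: inj_duality_map)
  moreover have "inv duality_map (G 0) = (0 :: 'a)"
    by (simp add: G_def I.zero)
  ultimately show thesis
    using that[of "\<lambda>t. inv duality_map (G t)"] by blast
qed

section \<open>Semigroups and energy\<close>

lemma constant_if_has_vector_derivative_zero:
  fixes f :: "real \<Rightarrow> 'a::real_normed_vector"
  assumes "\<And>t. t \<ge> 0 \<Longrightarrow> (f has_vector_derivative 0) (at t within {0..})" "a \<ge> 0" "b \<ge> 0"
  shows "f a = f b"
proof (rule has_vector_derivative_zero_constant[of "{0..}" f])
  show "f a = f b" if "\<And>x. x \<in> {0..} \<Longrightarrow> f x = c" for c
    using that[of a] that[of b] assms by simp
qed (use assms in auto)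

text \<open>For fixed \<open>h\<close>, the functions \<open>T h (F s)\<close> and \<open>F (s + h) - F h\<close> of \<open>s\<close> have the same
  derivative, so \<open>T h (F t) - F t = (F (t + h) - F t) - F h\<close>.\<close>

lemma generator_antiderivative:
  assumes T: "c0_semigroup T"
    and F: "F 0 = 0" "\<And>t. t \<ge> 0 \<Longrightarrow> (F has_vector_derivative T t x) (at t within {0..})"
    and "t \<ge> 0"
  shows "(F t, T t x - x) \<in> generator T"
proof -
  have shift: "T h (F t) - F t = (F (t + h) - F t) - F h" if "h \<ge> 0" for h
  proof -
    have "((\<lambda>s. T h (F s) - F (s + h)) has_vector_derivative 0) (at s within {0..})"
      if "s \<in> {0..}" for s
    proof -
      have TF: "((\<lambda>s. T h (F s)) has_vector_derivative T h (T s x)) (at s within {0..})"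
        by (rule bounded_linear.has_vector_derivative[of "T h"])
          (use T \<open>h \<ge> 0\<close> that F(2) in \<open>auto simp: c0_semigroup_def\<close>)
      have "(F has_vector_derivative T (s + h) x) (at (s + h) within {0..})"
        using that \<open>h \<ge> 0\<close> by (intro F(2)) auto
      then have "(F has_vector_derivative T (s + h) x) (at (s + h) within (\<lambda>s. s + h) ` {0..})"
        by (rule has_vector_derivative_within_subset) (use \<open>h \<ge> 0\<close> in auto)
      then have Fh: "((F \<circ> (\<lambda>s. s + h)) has_vector_derivative 1 *\<^sub>R T (s + h) x) (at s within {0..})"
        by (rule vector_diff_chain_within[rotated]) (auto intro!: derivative_eq_intros)
      have "T (s + h) x = T h (T s x)"
        using T \<open>h \<ge> 0\<close> that by (simp add: c0_semigroup_def add.commute[of s h])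
      then show ?thesis
        using has_vector_derivative_diff[OF TF Fh] by (simp add: o_def)
    qed
    then have "T h (F t) - F (t + h) = T h (F 0) - F (0 + h)"
      using \<open>t \<ge> 0\<close> by (intro constant_if_has_vector_derivative_zero) auto
    moreover have "T h 0 = 0"
      using T \<open>h \<ge> 0\<close> by (simp add: c0_semigroup_def linear_0 bounded_linear.linear)
    ultimately have "T h (F t) - F (t + h) = - F h"
      using F(1) by simp
    then show ?thesis
      by (simp add: algebra_simps)
  qed
  have quot: "((\<lambda>h. (1 / h) *\<^sub>R (F (s + h) - F s)) \<longlongrightarrow> T s x) (at_right 0)" if "s \<ge> 0" for s
  proof -
    have "(F has_vector_derivative T s x) (at_right s)"
      by (rule has_vector_derivative_within_subset[OF F(2)]) (use that in auto)
    then have "((\<lambda>y. (1 / norm (y - s)) *\<^sub>R (F y - (F s + (y - s) *\<^sub>R T s x))) \<longlongrightarrow> 0) (at_right s)"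
      by (simp add: has_vector_derivative_def has_derivative_within)
    then have "((\<lambda>h. (1 / norm h) *\<^sub>R (F (s + h) - (F s + h *\<^sub>R T s x))) \<longlongrightarrow> 0) (at_right 0)"
      by (simp add: filterlim_at_right_to_0[of _ _ s] add.commute[of s])
    then have "((\<lambda>h. (1 / norm h) *\<^sub>R (F (s + h) - (F s + h *\<^sub>R T s x)) + T s x) \<longlongrightarrow> 0 + T s x)
        (at_right 0)"
      by (intro tendsto_add tendsto_const)
    moreover have "\<forall>\<^sub>F h in at_right 0. (1 / norm h) *\<^sub>R (F (s + h) - (F s + h *\<^sub>R T s x)) + T s x
        = (1 / h) *\<^sub>R (F (s + h) - F s)"
      by (auto simp: eventually_at_right_field algebra_simps intro!: exI[of _ 1])
    ultimately show ?thesis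
      by (simp add: tendsto_cong)
  qed
  \<comment> \<open>The increments of \<open>F\<close> at \<open>t\<close> and at \<open>0\<close>
    in the shift identity contribute the right derivatives \<open>T t x\<close> and
    \<open>T 0 x = x\<close>.\<close>
  have "((\<lambda>h. (1 / h) *\<^sub>R (F (t + h) - F t) - (1 / h) *\<^sub>R (F (0 + h) - F 0)) \<longlongrightarrow> T t x - T 0 x)
      (at_right 0)"
    by (intro tendsto_diff quot) (use \<open>t \<ge> 0\<close> in auto)
  moreover have "T 0 x = x"
    using T by (auto simp: c0_semigroup_def)
  ultimately have "((\<lambda>h. (1 / h) *\<^sub>R (F (t + h) - F t) - (1 / h) *\<^sub>R F h) \<longlongrightarrow> T t x - x) (at_right 0)"
    using F(1) by simp
  moreover have "\<forall>\<^sub>F h in at_right 0. (1 / h) *\<^sub>R (T h (F t) - F t)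
      = (1 / h) *\<^sub>R (F (t + h) - F t) - (1 / h) *\<^sub>R F h"
    using shift by (auto simp: eventually_at_right_field scaleR_diff_right intro!: exI[of _ 1])
  ultimately show ?thesis
    unfolding generator_def by (auto simp: tendsto_cong)
qed

text \<open>Testing with \<open>\<phi> = U t\<close> makes the derivative of the energy vanish. The
  equation is the wave equation integrated once in time: \<open>P\<close> plays the displacement and
  its velocity \<open>U\<close> lies in the space of test vectors, which \<open>U'\<close> need not
  do.\<close>

lemma energy_conservation:
  fixes P U :: "real \<Rightarrow> 'x::real_inner" and U' :: "real \<Rightarrow> 'y::real_inner"
    and B :: "'x \<Rightarrow> 'x \<Rightarrow> real"
  assumes "bounded_bilinear B" and sym: "\<And>x y. B x y = B y x"
    and P: "\<And>t. t \<ge> 0 \<Longrightarrow> (P has_vector_derivative U t) (at t within {0..})"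
    and U': "\<And>t. t \<ge> 0 \<Longrightarrow> ((\<lambda>s. J (U s)) has_vector_derivative U' t) (at t within {0..})"
    and eq: "\<And>t \<phi>. t \<ge> 0 \<Longrightarrow> U' t \<bullet> J \<phi> + B (P t) \<phi> = 0"
    and "t \<ge> 0"
  shows "J (U t) \<bullet> J (U t) + B (P t) (P t) = J (U 0) \<bullet> J (U 0) + B (P 0) (P 0)"
proof -
  define E where "E t = J (U t) \<bullet> J (U t) + B (P t) (P t)" for t
  have "(E has_vector_derivative 0) (at t within {0..})" if "t \<in> {0..}" for t
  proof -
    have "t \<ge> 0" using that by simp
    have "((\<lambda>t. J (U t) \<bullet> J (U t)) has_vector_derivative J (U t) \<bullet> U' t + U' t \<bullet> J (U t))
        (at t within {0..})"
      by (intro bounded_bilinear.has_vector_derivative[OF bounded_bilinear_inner] U' \<open>t \<ge> 0\<close>)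
    moreover have "((\<lambda>t. B (P t) (P t)) has_vector_derivative B (P t) (U t) + B (U t) (P t))
        (at t within {0..})"
      by (intro bounded_bilinear.has_vector_derivative[OF assms(1)] P \<open>t \<ge> 0\<close>)
    moreover have "(J (U t) \<bullet> U' t + U' t \<bullet> J (U t)) + (B (P t) (U t) + B (U t) (P t)) = 0"
      using eq[OF \<open>t \<ge> 0\<close>, of "U t"] sym[of "U t" "P t"] by (simp add: inner_commute)
    ultimately show ?thesis
      unfolding E_def using has_vector_derivative_add by fastforce
  qed
  then have "E t = E 0"
    using \<open>t \<ge> 0\<close> by (intro constant_if_has_vector_derivative_zero) auto
  then show ?thesis
    by (simp add: E_def)
qed

section \<open>Matrices acting on vectors\<close>

lemma bounded_linear_vecI:
  fixes f :: "'a::real_normed_vector \<Rightarrow> 'b::real_normed_vector^'n"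
  assumes "\<And>i. bounded_linear (\<lambda>x. f x $ i)"
  shows "bounded_linear f"
proof -
  have "\<exists>K. \<forall>x. norm (f x $ i) \<le> norm x * K" for i
    using bounded_linear.bounded[OF assms] by blast
  then obtain K where K: "\<And>i x. norm (f x $ i) \<le> norm x * K i"
    by metis
  show ?thesis
  proof (rule bounded_linear_intro)
    fix x y :: 'a and r :: real
    show "f (x + y) = f x + f y" "f (r *\<^sub>R x) = r *\<^sub>R f x"
      using bounded_linear.linear[OF assms] by (auto simp: vec_eq_iff linear_iff)
    have "norm (f x) \<le> (\<Sum>i\<in>UNIV. norm (f x $ i))"
      unfolding norm_vec_def by (rule L2_set_le_sum) simp
    also have "\<dots> \<le> (\<Sum>i\<in>UNIV. norm x * K i)"
      by (intro sum_mono K)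
    finally show "norm (f x) \<le> norm x * (\<Sum>i\<in>UNIV. K i)"
      by (simp add: sum_distrib_left)
  qed
qed

lemma bounded_linear_componentwise:
  assumes "bounded_linear f"
  shows "bounded_linear (componentwise f :: _^'n \<Rightarrow> _)"
  by (rule bounded_linear_vecI)
    (simp add: componentwise_def bounded_linear_compose[OF assms bounded_linear_vec_nth])

lemma bounded_linear_mat_act:
  "bounded_linear (mat_act M :: 'a::real_normed_vector^'n \<Rightarrow> _)"
  by (rule bounded_linear_vecI)
    (auto simp: mat_act_def intro!: bounded_linear_sum
      bounded_linear_compose[OF bounded_linear_scaleR_right bounded_linear_vec_nth])

lemma linear_mat_act: "linear (mat_act M)"
  by (rule linearI)
    (simp_all add: mat_act_def vec_eq_iff scaleR_add_right sum.distrib scaleR_sum_right mult.commute)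

lemma mat_act_mult: "mat_act (M ** R) x = mat_act M (mat_act R x)"
proof -
  have "(\<Sum>j\<in>UNIV. (\<Sum>k\<in>UNIV. M $ i $ k * R $ k $ j) *\<^sub>R x $ j)
      = (\<Sum>k\<in>UNIV. M $ i $ k *\<^sub>R (\<Sum>j\<in>UNIV. R $ k $ j *\<^sub>R x $ j))" for i
    unfolding scaleR_sum_left scaleR_sum_right scaleR_scaleR by (rule sum.swap)
  then show ?thesis
    by (simp add: mat_act_def matrix_matrix_mult_def vec_eq_iff)
qed

lemma componentwise_mat_act:
  "linear f \<Longrightarrow> componentwise f (mat_act M x) = mat_act M (componentwise f x)"
  by (simp add: componentwise_def mat_act_def vec_eq_iff linear_sum linear_scale)

text \<open>The elementary tensor \<open>e \<otimes> u\<close>: matrices act on the factor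
  \<open>e\<close>, componentwise operators on the factor \<open>u\<close>.\<close>

definition tensor :: "real^'n \<Rightarrow> 'a::real_vector \<Rightarrow> 'a^'n" where
  "tensor e u = (\<chi> i. e $ i *\<^sub>R u)"

lemma mat_act_tensor: "mat_act M (tensor e u) = tensor (M *v e) u"
  by (simp add: mat_act_def tensor_def vec_eq_iff matrix_vector_mult_def scaleR_sum_left)

lemma componentwise_tensor: "linear f \<Longrightarrow> componentwise f (tensor e u) = tensor e (f u)"
  by (simp add: componentwise_def tensor_def vec_eq_iff linear_scale)

lemma tensor_eq_0_iff: "tensor e u = 0 \<longleftrightarrow> e = 0 \<or> u = 0"
  by (auto simp: tensor_def vec_eq_iff)

lemma inner_mat_act:
  fixes x y :: "'a::real_inner^'n"
  assumes "transpose A = A"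
  shows "mat_act A x \<bullet> y = x \<bullet> mat_act A y"
proof -
  have A: "A $ i $ j = A $ j $ i" for i j
    using assms by (metis transpose_def vec_lambda_beta)
  have "mat_act A x \<bullet> y = (\<Sum>i\<in>UNIV. \<Sum>j\<in>UNIV. A $ i $ j * (x $ j \<bullet> y $ i))"
    by (simp add: inner_vec_def mat_act_def inner_sum_left)
  also have "\<dots> = (\<Sum>j\<in>UNIV. \<Sum>i\<in>UNIV. A $ j $ i * (x $ j \<bullet> y $ i))"
    by (subst sum.swap) (simp add: A)
  finally show ?thesis
    by (simp add: inner_vec_def mat_act_def inner_sum_right)
qed

text \<open>In an orthogonal basis \<open>B\<close> of the span of the components of \<open>x\<close> the form splits into
  \<open>\<Sum>b\<in>B. |b|\<^sup>2 (c\<^sub>b \<bullet> A c\<^sub>b)\<close> with coordinate vectors \<open>c\<^sub>b\<close>.\<close>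

lemma inner_mat_act_nonneg:
  fixes x :: "'a::real_inner^'n"
  assumes "\<And>c. 0 \<le> c \<bullet> (A *v c)"
  shows "0 \<le> x \<bullet> mat_act A x"
proof -
  obtain B where B: "finite B" "span B = span (range (\<lambda>i. x $ i))" "pairwise orthogonal B"
    using basis_orthogonal[of "range (\<lambda>i. x $ i)"] by auto
  have "\<exists>c. x $ i = (\<Sum>b\<in>B. c b *\<^sub>R b)" for i
    using span_finite[OF B(1)] B(2) by (metis (no_types, lifting) imageE rangeI span_base)
  then obtain c where c: "\<And>i. x $ i = (\<Sum>b\<in>B. c i b *\<^sub>R b)"
    by metis
  have orth: "b \<bullet> d = 0" if "b \<in> B" "d \<in> B" "d \<noteq> b" for b d
    using B(3) that by (auto simp: pairwise_def orthogonal_def)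
  have xx: "x $ i \<bullet> x $ j = (\<Sum>b\<in>B. (b \<bullet> b) * (c i b * c j b))" for i j
  proof -
    have "x $ i \<bullet> x $ j = (\<Sum>d\<in>B. \<Sum>b\<in>B. c j d * (c i b * (d \<bullet> b)))"
      by (simp add: c inner_sum_left inner_sum_right sum_distrib_left inner_commute)
    also have "\<dots> = (\<Sum>d\<in>B. \<Sum>b\<in>B. if b = d then c j d * (c i d * (d \<bullet> d)) else 0)"
      by (intro sum.cong refl) (simp add: orth)
    finally show ?thesis
      using B(1) by (simp add: algebra_simps)
  qed
  have "x \<bullet> mat_act A x = (\<Sum>i\<in>UNIV. \<Sum>j\<in>UNIV. A $ i $ j * (x $ i \<bullet> x $ j))"
    by (simp add: inner_vec_def mat_act_def inner_sum_right)
  also have "\<dots> = (\<Sum>i\<in>UNIV. \<Sum>j\<in>UNIV. \<Sum>b\<in>B. (b \<bullet> b) * (c i b * (A $ i $ j * c j b)))"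
    by (simp add: xx sum_distrib_left algebra_simps)
  also have "\<dots> = (\<Sum>i\<in>UNIV. \<Sum>b\<in>B. \<Sum>j\<in>UNIV. (b \<bullet> b) * (c i b * (A $ i $ j * c j b)))"
    by (rule sum.cong[OF refl], rule sum.swap)
  also have "\<dots> = (\<Sum>b\<in>B. \<Sum>i\<in>UNIV. \<Sum>j\<in>UNIV. (b \<bullet> b) * (c i b * (A $ i $ j * c j b)))"
    by (rule sum.swap)
  also have "\<dots> = (\<Sum>b\<in>B. (b \<bullet> b) * ((\<chi> i. c i b) \<bullet> (A *v (\<chi> i. c i b))))"
    by (simp add: inner_vec_def matrix_vector_mult_def sum_distrib_left)
  also have "\<dots> \<ge> 0"
    using assms by (intro sum_nonneg mult_nonneg_nonneg) auto
  finally show ?thesis .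
qed

text \<open>With \<open>h\<close> a linear right inverse of \<open>M\<close> on its range,
  \<open>x - h (M *v x)\<close> lies in \<open>Ker M\<close> and is therefore annihilated by
  \<open>M'\<close>; thus \<open>R\<close> is \<open>M'\<close> composed with
  \<open>h\<close>.\<close>

lemma Ker_subset_imp_factor:
  fixes M :: "real^'n^'m" and M' :: "real^'n^'k"
  assumes "Ker M \<subseteq> Ker M'"
  obtains R where "M' = R ** M"
proof -
  obtain h where h: "linear h" "\<And>v. v \<in> range ((*v) M) \<Longrightarrow> M *v h v = v"
    using linear_exists_right_inverse_on[of "(*v) M" UNIV] by auto
  have "M' *v x = (M' ** matrix h ** M) *v x" for x
  proof -
    have "M *v (x - h (M *v x)) = 0"
      using h(2)[of "M *v x"] by (simp add: matrix_vector_mult_diff_distrib)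
    then have "M' *v (x - h (M *v x)) = 0"
      using assms by (auto simp: Ker_def)
    then show ?thesis
      using h(1) by (simp add: matrix_vector_mult_diff_distrib matrix_works
          flip: matrix_vector_mul_assoc)
  qed
  then show thesis
    using that matrix_eq by blast
qed

text \<open>Factoring \<open>M'\<close> through \<open>M\<close> carries a kernel inclusion in
  \<real>^N over to vectors with components in any real vector space.\<close>

lemma mat_act_eq_0_mono:
  assumes "Ker M \<subseteq> Ker M'" "mat_act M x = 0"
  shows "mat_act M' x = 0"
proof -
  obtain R where "M' = R ** M"
    by (rule Ker_subset_imp_factor[OF assms(1)])
  then show ?thesis
    using assms(2) by (simp add: mat_act_mult linear_0[OF linear_mat_act])
qed

section \<open>Row spaces and eigenvectors of real matrices\<close>

lemma inner_matrix_vector_mult: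
  fixes M :: "real^'n^'m"
  shows "(M *v x) \<bullet> y = x \<bullet> (transpose M *v y)"
  by (metis dot_lmul_matrix vector_transpose_matrix)

text \<open>The row space of \<open>M ** D\<close> lies in that of \<open>D\<close> and has the same
  dimension, so the two coincide, and so do their orthogonal complements, the kernels.\<close>

lemma Ker_mult_subset_if_rank_eq:
  fixes M :: "real^'m^'k" and D :: "real^'n^'m"
  assumes "rank (M ** D) = rank D"
  shows "Ker (M ** D) \<subseteq> Ker D"
proof
  fix x assume "x \<in> Ker (M ** D)"
  let ?S = "range ((*v) (transpose (M ** D)))" and ?T = "range ((*v) (transpose D))"
  have "?S \<subseteq> ?T"
    by (auto simp: matrix_transpose_mul simp flip: matrix_vector_mul_assoc)
  moreover have "dim ?T \<le> dim ?S"
    using assms by (simp only: rank_transpose flip: rank_dim_range)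
  moreover have "subspace ?S" "subspace ?T"
    by (intro linear_subspace_image matrix_vector_mul_linear subspace_UNIV)+
  ultimately have eq: "?S = ?T"
    by (intro subspace_dim_equal)
  have "transpose D *v (D *v x) \<in> ?S"
    unfolding eq by (rule rangeI)
  then obtain y where y: "transpose D *v (D *v x) = transpose (M ** D) *v y"
    by (rule rangeE)
  have "(D *v x) \<bullet> (D *v x) = ((M ** D) *v x) \<bullet> y"
    unfolding inner_matrix_vector_mult y ..
  also have "\<dots> = 0"
    using \<open>x \<in> Ker (M ** D)\<close> by (simp add: Ker_def)
  finally show "x \<in> Ker D"
    by (simp add: Ker_def)
qed

text \<open>A maximizer of \<open>x \<bullet> A x\<close> on the unit sphere of the subspace is an eigenvector.\<close>

lemma symmetric_matrix_has_eigenvector: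
  fixes A :: "real^'n^'n"
  assumes A: "transpose A = A" and S: "subspace S" "\<And>x. x \<in> S \<Longrightarrow> A *v x \<in> S"
    and ne: "x\<^sub>0 \<in> S" "x\<^sub>0 \<noteq> 0"
  obtains f \<mu> where "f \<in> S" "f \<noteq> 0" "A *v f = \<mu> *\<^sub>R f"
proof -
  let ?q = "\<lambda>x. x \<bullet> (A *v x)"
  have sym: "(A *v x) \<bullet> y = x \<bullet> (A *v y)" for x y
    by (simp only: inner_matrix_vector_mult A)
  have "compact (sphere 0 1 \<inter> S)"
    using S(1) by (intro compact_Int_closed closed_subspace) auto
  moreover have "x\<^sub>0 /\<^sub>R norm x\<^sub>0 \<in> sphere 0 1 \<inter> S"
    using ne S(1) by (auto simp: subspace_scale)
  moreover have "continuous_on (sphere 0 1 \<inter> S) ?q"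
    by (intro continuous_intros linear_continuous_on matrix_vector_mul_bounded_linear)
  ultimately obtain f where f: "f \<in> sphere 0 1 \<inter> S"
    and max: "\<And>y. y \<in> sphere 0 1 \<inter> S \<Longrightarrow> ?q y \<le> ?q f"
    using continuous_attains_sup[of "sphere 0 1 \<inter> S" ?q] by blast
  have ff: "f \<bullet> f = 1"
    using f by (simp add: norm_eq_1)
  \<comment> \<open>Homogeneity extends maximality from the unit sphere to all of
    \<open>S\<close>.\<close>
  have le: "?q y \<le> ?q f * (y \<bullet> y)" if "y \<in> S" for y
  proof (cases "y = 0")
    case False
    have "?q (y /\<^sub>R norm y) \<le> ?q f"
      using False that S(1) by (intro max) (auto simp: subspace_scale)
    moreover have "?q (y /\<^sub>R norm y) = ?q y / (norm y)\<^sup>2"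
      by (simp add: matrix_vector_mult_scaleR power2_eq_square divide_inverse)
    ultimately show ?thesis
      using False by (simp add: divide_le_eq flip: power2_norm_eq_inner)
  qed simp
  \<comment> \<open>The residual \<open>v\<close> lies in \<open>S\<close> by invariance, hence is
    an admissible direction; the first-order condition at \<open>f\<close> in this direction says
    \<open>v \<bullet> v = 0\<close>.\<close>
  define v where "v = A *v f - ?q f *\<^sub>R f"
  have v: "v \<in> S"
    using f S by (simp add: v_def subspace_diff subspace_scale)
  have "0 \<le> 2 * t * (?q f * (f \<bullet> v) - (A *v f) \<bullet> v) + t\<^sup>2 * (?q f * (v \<bullet> v) - ?q v)" for t
  proof -
    have "f + t *\<^sub>R v \<in> S"
      using f v S(1) by (simp add: subspace_add subspace_scale)
    moreover have "v \<bullet> f = f \<bullet> v" "v \<bullet> (A *v f) = f \<bullet> (A *v v)" "(A *v f) \<bullet> v = f \<bullet> (A *v v)"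
      using sym[of f v] by (auto simp: inner_commute)
    ultimately show ?thesis
      using le[of "f + t *\<^sub>R v"] ff
      by (simp add: matrix_vector_right_distrib matrix_vector_mult_scaleR inner_add_left
          inner_add_right algebra_simps power2_eq_square)
  qed
  then have "?q f * (f \<bullet> v) - (A *v f) \<bullet> v = 0"
    by (rule linear_coeff_zero_if_quadratic_nonneg)
  moreover have "v \<bullet> v = (A *v f) \<bullet> v - ?q f * (f \<bullet> v)"
    using inner_diff_left[of "A *v f" "?q f *\<^sub>R f" v] unfolding v_def[symmetric] by simp
  ultimately have "v \<bullet> v = 0"
    by linarith
  then have "A *v f = ?q f *\<^sub>R f"
    by (simp add: v_def)
  moreover have "f \<noteq> 0" "f \<in> S"
    using ff f by auto
  ultimately show thesis
    using that by blast
qed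

section \<open>Synchronized solutions\<close>

lemma pivot_apply:
  "bounded_linear J \<Longrightarrow> blinfun_apply (pivot J h) v = h \<bullet> J v"
  unfolding pivot_def
  by (simp add: bounded_linear_Blinfun_apply bounded_linear_inner_right_comp)

lemma linear_pivot:
  "bounded_linear J \<Longrightarrow> linear (pivot J)"
  by (rule linearI; rule blinfun_eqI) (simp_all add: pivot_apply inner_add_left blinfun.bilinear_simps)

lemma dense_compact_embedding_nonzero:
  fixes J :: "'a::real_normed_vector \<Rightarrow> 'b::real_normed_vector" and h :: 'b
  assumes "dense_compact_embedding J" "h \<noteq> 0"
  obtains v where "J v \<noteq> 0"
proof -
  have "\<not> range J \<subseteq> {0}"
  proof
    assume "range J \<subseteq> {0}"
    then have "closure (range J) \<subseteq> {0}"
      by (rule closure_minimal) simp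
    then have "(UNIV :: 'b set) \<subseteq> {0}"
      using assms(1) by (simp add: dense_compact_embedding_def)
    then have "h \<in> {0}"
      by (rule subsetD) (rule UNIV_I)
    then show False
      using assms(2) by simp
  qed
  then obtain v where "J v \<noteq> 0"
    by auto
  then show thesis
    by (rule that)
qed

text \<open>A mild solution need not stay in the domain of the generator, but its time primitive
  does, with the increment of the state as image. Reading off the graph of
  \<open>wave_operator\<close> gives the equation integrated in time.\<close>

lemma mild_solution_primitive:
  fixes J :: "'v::{real_inner,complete_space} \<Rightarrow> 'h::{real_inner,complete_space}"
    and U :: "real \<Rightarrow> 'v^'n"
  assumes "mild_solution J g A D U0 U1 U U'"
  obtains P where "P 0 = 0"
    and "\<And>t. t \<ge> 0 \<Longrightarrow> (P has_vector_derivative U t) (at t within {0..})"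
    and "\<And>t. t \<ge> 0 \<Longrightarrow> componentwise (pivot J) (U' t - U1) =
        - componentwise duality_map (P t)
        - componentwise (pivot J) (componentwise J (mat_act A (P t)))
        - mat_act D (componentwise g (U t - U0))"
proof -
  obtain T where T: "c0_semigroup T" "generator T = wave_operator J g A D"
    and TU: "\<And>t. t \<ge> 0 \<Longrightarrow> T t (U0, U1) = (U t, U' t)"
    using assms by (auto simp: mild_solution_def)
  have "continuous_on {0..} (\<lambda>t. (U t, U' t))"
    using assms by (auto simp: mild_solution_def intro: continuous_on_Pair)
  then obtain F where F: "F 0 = 0"
      "\<And>t. t \<ge> 0 \<Longrightarrow> (F has_vector_derivative (U t, U' t)) (at t within {0..})"
    using continuous_on_imp_antiderivative by blast
  have gen: "(F t, (U t - U0, U' t - U1)) \<in> wave_operator J g A D" if "t \<ge> 0" for t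
    using generator_antiderivative[OF T(1), of F "(U0, U1)" t] F TU that T(2) by simp
  show thesis
  proof (rule that[of "\<lambda>t. fst (F t)"])
    show "fst (F 0) = 0"
      by (simp add: F)
    show "((\<lambda>t. fst (F t)) has_vector_derivative U t) (at t within {0..})" if "t \<ge> 0" for t
      using bounded_linear.has_vector_derivative[OF bounded_linear_fst F(2)[OF that]] by simp
    show "componentwise (pivot J) (U' t - U1) =
        - componentwise duality_map (fst (F t))
        - componentwise (pivot J) (componentwise J (mat_act A (fst (F t))))
        - mat_act D (componentwise g (U t - U0))" if "t \<ge> 0" for t
      using gen[OF that] by (auto simp: wave_operator_def)
  qed
qed

text \<open>The uniform estimate makes the states annihilated by \<open>C\<close> an invariant subspace.\<close>

lemma uniformly_synchronizable_annihilated: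
  assumes "uniformly_synchronizable J g A D C" "mat_act C U0 = 0" "mat_act C U1 = 0"
  obtains U U' where "mild_solution J g A D U0 U1 U U'"
    "\<And>t. t \<ge> 0 \<Longrightarrow> mat_act C (U t) = 0" "\<And>t. t \<ge> 0 \<Longrightarrow> mat_act C (U' t) = 0"
proof -
  obtain M \<omega> where "\<forall>U0 U1. \<exists>U U'. mild_solution J g A D U0 U1 U U' \<and>
      (\<forall>t\<ge>0. norm (mat_act C (U t), mat_act C (U' t))
        \<le> M * exp (- \<omega> * t) * norm (mat_act C U0, mat_act C U1))"
    using assms(1) unfolding uniformly_synchronizable_def by blast
  then obtain U U' where U: "mild_solution J g A D U0 U1 U U'"
    and le: "\<forall>t\<ge>0. norm (mat_act C (U t), mat_act C (U' t))
        \<le> M * exp (- \<omega> * t) * norm (mat_act C U0, mat_act C U1)"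
    by blast
  show thesis
  proof (rule that[OF U])
    show "mat_act C (U t) = 0" "mat_act C (U' t) = 0" if "t \<ge> 0" for t
      using le that assms(2,3) by (simp_all add: zero_prod_def)
  qed
qed

text \<open>Differentiating the solution with data \<open>(e \<otimes> u, 0)\<close> at \<open>t = 0\<close>, where \<open>u\<close> solves \<open>L u = h\<close>
  with \<open>h\<close> in \<open>H\<close>, gives \<open>C A e \<otimes> u = 0\<close>.\<close>

lemma uniformly_synchronizable_imp_compatible:
  fixes J :: "'v::{real_inner,complete_space} \<Rightarrow> 'h::{real_inner,complete_space}"
    and A D :: "real^'n^'n"
  assumes "\<exists>h::'h. h \<noteq> 0" and triple: "hilbert_triple J" and g: "symmetric_nonneg_operator g"
    and sync: "uniformly_synchronizable J g A D C"
  shows "Ker C \<subseteq> Ker (C ** A)"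
proof
  fix e assume "e \<in> Ker C"
  then have Ce: "C *v e = 0"
    by (simp add: Ker_def)
  have J: "bounded_linear J" "inj J"
    using triple by (auto simp: hilbert_triple_def dense_compact_embedding_def)
  have J0: "J v = 0 \<longleftrightarrow> v = 0" for v
    using J by (metis bounded_linear.linear injD linear_0)
  note lin = J(1)[THEN bounded_linear.linear] linear_pivot[OF J(1)]
  obtain v where "J v \<noteq> 0"
    using dense_compact_embedding_nonzero triple assms(1) by (auto simp: hilbert_triple_def)
  obtain u where u: "duality_map u = pivot J (J v)"
    using riesz_representation by blast
  have "u \<noteq> 0"
  proof
    assume "u = 0"
    with u have "J v \<bullet> J v = 0"
      using duality_map_apply[of u v] pivot_apply[OF J(1), of "J v" v] by simp
    with \<open>J v \<noteq> 0\<close> show False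
      by simp
  qed
  \<comment> \<open>\<open>W\<close> is the initial acceleration: the choice of \<open>u\<close>
    turns \<open>L\<close> applied to \<open>e \<otimes> u\<close> into the element
    \<open>e \<otimes> J v\<close> of \<open>H^N\<close>, so the data lie in the domain of the
    generator.\<close>
  define W where "W = - tensor e (J v) - componentwise J (mat_act A (tensor e u))"
  have "componentwise (pivot J) W =
      - componentwise duality_map (tensor e u)
      - componentwise (pivot J) (componentwise J (mat_act A (tensor e u)))
      - mat_act D (componentwise g 0)"
  proof -
    have "mat_act D (componentwise g 0) = 0"
      using g by (simp add: symmetric_nonneg_operator_def componentwise_def vec_eq_iff
          mat_act_def linear_0 bounded_linear.linear)
    moreover have "componentwise duality_map (tensor e u) = componentwise (pivot J) (tensor e (J v))"
      using u lin(2) by (simp add: componentwise_tensor linear_duality_map)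
    ultimately show ?thesis
      using lin(2) by (simp add: W_def componentwise_def vec_eq_iff linear_diff linear_neg)
  qed
  moreover have "componentwise J (0 :: 'v^'n) = 0"
    using J0 by (simp add: componentwise_def vec_eq_iff)
  ultimately have dom: "((tensor e u, 0), (0, W)) \<in> wave_operator J g A D"
    unfolding wave_operator_def mem_Collect_eq
    by (intro exI[of _ "tensor e u"] exI[of _ "0 :: 'v^'n"] exI[of _ W]) simp
  have "mat_act C (tensor e u) = 0" "mat_act C (0 :: 'h^_) = 0"
    using Ce by (simp_all add: mat_act_tensor tensor_eq_0_iff linear_0[OF linear_mat_act])
  then obtain U U' where U: "mild_solution J g A D (tensor e u) 0 U U'"
    and CU': "\<And>t. t \<ge> 0 \<Longrightarrow> mat_act C (U' t) = 0"
    using uniformly_synchronizable_annihilated[OF sync] by blast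
  then obtain T where T: "generator T = wave_operator J g A D"
    and TU: "\<And>t. t \<ge> 0 \<Longrightarrow> T t (tensor e u, 0) = (U t, U' t)"
    by (auto simp: mild_solution_def)
  \<comment> \<open>The velocity component of the difference quotient is annihilated by
    \<open>C\<close> for \<open>t > 0\<close>, hence so is its limit \<open>W\<close>.\<close>
  have "((\<lambda>t. (1 / t) *\<^sub>R (T t (tensor e u, 0) - (tensor e u, 0))) \<longlongrightarrow> (0, W)) (at_right 0)"
    using dom T by (auto simp: generator_def)
  then have "((\<lambda>t. mat_act C (snd ((1 / t) *\<^sub>R (T t (tensor e u, 0) - (tensor e u, 0)))))
      \<longlongrightarrow> mat_act C (snd (0 :: 'v^'n, W))) (at_right 0)"
    by (intro bounded_linear.tendsto[OF bounded_linear_mat_act] tendsto_snd)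
  moreover have "\<forall>\<^sub>F t in at_right 0.
      mat_act C (snd ((1 / t) *\<^sub>R (T t (tensor e u, 0) - (tensor e u, 0)))) = 0"
    by (auto simp: eventually_at_right_field TU CU' linear_scale[OF linear_mat_act] intro!: exI[of _ 1])
  ultimately have "((\<lambda>t. 0) \<longlongrightarrow> mat_act C (snd (0 :: 'v^'n, W))) (at_right (0::real))"
    by (rule Lim_transform_eventually)
  then have "mat_act C W = 0"
    by (simp add: tendsto_const_iff)
  moreover have "mat_act C W = - tensor (C *v e) (J v) - tensor ((C ** A) *v e) (J u)"
    unfolding W_def linear_diff[OF linear_mat_act] linear_neg[OF linear_mat_act] mat_act_tensor
      componentwise_tensor[OF lin(1)] matrix_vector_mul_assoc ..
  moreover have "tensor (C *v e) (J v) = 0"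
    using Ce by (simp add: tensor_eq_0_iff)
  ultimately have "tensor ((C ** A) *v e) (J u) = 0"
    by simp
  then show "e \<in> Ker (C ** A)"
    using \<open>u \<noteq> 0\<close> J0 by (simp add: tensor_eq_0_iff Ker_def)
qed

text \<open>Covers the potential energy forms used below: the inner product of \<open>V\<close> or
  \<open>V^N\<close> plus a zeroth-order coupling measured in \<open>H\<close> or
  \<open>H^N\<close>.\<close>

lemma bounded_bilinear_inner_add_inner:
  fixes f k :: "'a::real_inner \<Rightarrow> 'b::real_inner"
  assumes f: "bounded_linear f" and k: "bounded_linear k"
  shows "bounded_bilinear (\<lambda>x y. x \<bullet> y + f x \<bullet> k y)"
proof -
  interpret f: bounded_linear f by fact
  interpret k: bounded_linear k by fact
  interpret fk: bounded_bilinear "\<lambda>x y. f x \<bullet> k y"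
    by (rule bounded_bilinear.comp[OF bounded_bilinear_inner f k])
  obtain K where K: "\<And>x y. norm (f x \<bullet> k y) \<le> norm x * norm y * K"
    using fk.bounded by blast
  show ?thesis
  proof
    have "norm (x \<bullet> y + f x \<bullet> k y) \<le> norm x * norm y * (1 + K)" for x y
      using norm_triangle_ineq[of "x \<bullet> y" "f x \<bullet> k y"] K[of x y] Cauchy_Schwarz_ineq2[of x y]
      by (simp add: distrib_left)
    then show "\<exists>K. \<forall>x y. norm (x \<bullet> y + f x \<bullet> k y) \<le> norm x * norm y * K"
      by blast
  qed (simp_all add: inner_simps f.add k.add f.scaleR k.scaleR algebra_simps)
qed

text \<open>The solution \<open>U\<close> with data \<open>(e \<otimes> u, 0)\<close> stays in the kernel of \<open>C\<close>, which forces
  \<open>D G (U t - U 0) = 0\<close>. It therefore solves the undamped equation, and energy conservation bounds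
  its primitive \<open>P\<close>. Since \<open>D G (P t) = t D G (U 0)\<close>, letting \<open>t\<close> grow gives \<open>D G (U 0) = 0\<close>.\<close>

lemma uniformly_synchronizable_damping_on_Ker:
  fixes J :: "'v::{real_inner,complete_space} \<Rightarrow> 'h::{real_inner,complete_space}"
    and A D :: "real^'n^'n"
  assumes J: "bounded_linear J" and g: "symmetric_nonneg_operator g"
    and A: "symmetric_psd A" and sync: "uniformly_synchronizable J g A D C"
    and CA: "Ker C \<subseteq> Ker (C ** A)" and CD: "Ker (C ** D) \<subseteq> Ker D" and e: "e \<in> Ker C"
  shows "tensor (D *v e) (g u) = 0"
proof -
  note bl = bounded_linear_mat_act bounded_linear_componentwise
  have linJ: "linear J" and linp: "linear (pivot J)" and blg: "bounded_linear g" and ling: "linear g"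
    using J g linear_pivot by (auto simp: symmetric_nonneg_operator_def bounded_linear.linear)
  have comp0: "componentwise f 0 = 0" if "linear f" for f :: "'x::real_vector \<Rightarrow> 'y::real_vector"
    using that by (simp add: componentwise_def vec_eq_iff linear_0)
  let ?U0 = "tensor e u"
  have "mat_act C ?U0 = 0" "mat_act C (0 :: 'h^_) = 0"
    using e by (simp_all add: mat_act_tensor tensor_eq_0_iff linear_0[OF linear_mat_act] Ker_def)
  then obtain U U' where U: "mild_solution J g A D ?U0 0 U U'"
    and CU: "\<And>t. t \<ge> 0 \<Longrightarrow> mat_act C (U t) = 0" and CU': "\<And>t. t \<ge> 0 \<Longrightarrow> mat_act C (U' t) = 0"
    using uniformly_synchronizable_annihilated[OF sync] by blast
  obtain P where P0: "P 0 = 0"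
    and P: "\<And>t. t \<ge> 0 \<Longrightarrow> (P has_vector_derivative U t) (at t within {0..})"
    and eq: "\<And>t. t \<ge> 0 \<Longrightarrow> componentwise (pivot J) (U' t - 0) =
        - componentwise duality_map (P t)
        - componentwise (pivot J) (componentwise J (mat_act A (P t)))
        - mat_act D (componentwise g (U t - ?U0))"
    using mild_solution_primitive[OF U] by blast
  have CP: "mat_act C (P t) = 0" if "t \<ge> 0" for t
  proof -
    have "((\<lambda>s. mat_act C (P s)) has_vector_derivative 0) (at s within {0..})" if "s \<ge> 0" for s
      using bounded_linear.has_vector_derivative[OF bl(1) P[OF that], of C] CU[OF that] by simp
    then have "mat_act C (P t) = mat_act C (P 0)"
      using that by (intro constant_if_has_vector_derivative_zero[of "\<lambda>s. mat_act C (P s)"]) auto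
    then show ?thesis
      by (simp add: P0 linear_0[OF linear_mat_act])
  qed
  \<comment> \<open>Applying \<open>C\<close> to the integrated equation removes every term except
    the damping, since \<open>P t\<close>, \<open>A (P t)\<close> and \<open>U' t\<close> are
    annihilated by \<open>C\<close>; the inclusion \<open>CD\<close> then removes
    \<open>C\<close>.\<close>
  have DG: "mat_act D (componentwise g (U t - ?U0)) = 0" if "t \<ge> 0" for t
  proof -
    have "mat_act C (mat_act A (P t)) = 0"
      using mat_act_eq_0_mono[OF CA CP[OF that]] by (simp add: mat_act_mult)
    then have "mat_act C (mat_act D (componentwise g (U t - ?U0))) = 0"
      using arg_cong[OF eq[OF that], of "mat_act C"] CP[OF that] CU'[OF that]
      by (simp add: linear_diff[OF linear_mat_act] linear_neg[OF linear_mat_act] comp0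
          linJ linp linear_duality_map flip: componentwise_mat_act)
    then show ?thesis
      by (intro mat_act_eq_0_mono[OF CD]) (simp add: mat_act_mult)
  qed
  have wave: "U' t \<bullet> componentwise J \<phi>
      + (P t \<bullet> \<phi> + componentwise J (mat_act A (P t)) \<bullet> componentwise J \<phi>) = 0" if "t \<ge> 0" for t \<phi>
  proof -
    have "pivot J (U' t $ i) = - duality_map (P t $ i) - pivot J (J (mat_act A (P t) $ i))" for i
      using eq[OF that] DG[OF that] by (simp add: vec_eq_iff componentwise_def)
    then have "U' t $ i \<bullet> J (\<phi> $ i) = - (P t $ i \<bullet> \<phi> $ i) - J (mat_act A (P t) $ i) \<bullet> J (\<phi> $ i)" for i
      using arg_cong[of _ _ "\<lambda>F. blinfun_apply F (\<phi> $ i)"]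
      by (simp add: pivot_apply[OF J, symmetric] blinfun.bilinear_simps)
    then show ?thesis
      by (simp add: inner_vec_def componentwise_def sum_subtractf sum_negf)
  qed
  let ?B = "\<lambda>x y. x \<bullet> y + componentwise J (mat_act A x) \<bullet> componentwise J y"
  have JA: "componentwise J (mat_act A x) = mat_act A (componentwise J x)" for x
    by (rule componentwise_mat_act[OF linJ])
  \<comment> \<open>This is the full initial energy, because \<open>P 0 = 0\<close>.\<close>
  define E where "E = componentwise J (U 0) \<bullet> componentwise J (U 0)"
  have "norm (P t) \<le> sqrt E" if "t \<ge> 0" for t
  proof -
    have "componentwise J (U t) \<bullet> componentwise J (U t) + ?B (P t) (P t)
        = componentwise J (U 0) \<bullet> componentwise J (U 0) + ?B (P 0) (P 0)"
    proof (rule energy_conservation[where U' = U' and J = "componentwise J" and B = ?B])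
      show "bounded_bilinear ?B"
        by (intro bounded_bilinear_inner_add_inner bl J
            bounded_linear_compose[of "componentwise J" "mat_act A"])
      show "?B x y = ?B y x" for x y
        using inner_mat_act[of A "componentwise J x" "componentwise J y"] A
        by (simp add: JA symmetric_psd_def inner_commute)
      show "((\<lambda>s. componentwise J (U s)) has_vector_derivative U' t) (at t within {0..})"
        if "t \<ge> 0" for t
        using U that by (simp add: mild_solution_def)
    qed (use P wave that in auto)
    moreover have "0 \<le> componentwise J (mat_act A (P t)) \<bullet> componentwise J (P t)"
      using A inner_mat_act_nonneg[of A "componentwise J (P t)"]
      by (simp add: JA symmetric_psd_def inner_commute)
    moreover have "0 \<le> componentwise J (U t) \<bullet> componentwise J (U t)"
      by simp
    moreover have "?B (P 0) (P 0) = 0"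
      by (simp add: P0 comp0[OF linJ])
    ultimately have "P t \<bullet> P t \<le> E"
      unfolding E_def by linarith
    then show ?thesis
      by (simp add: norm_eq_sqrt_inner)
  qed
  note bound = this
  let ?q = "\<lambda>x. mat_act D (componentwise g x)"
  have q: "bounded_linear ?q"
    by (intro bounded_linear_compose[OF bl(1) bl(2)] blg)
  define w where "w = ?q ?U0"
  have qP: "?q (P t) = t *\<^sub>R w" if "t \<ge> 0" for t
  proof -
    have "((\<lambda>s. ?q (P s) - s *\<^sub>R w) has_vector_derivative 0) (at s within {0..})" if "s \<ge> 0" for s
    proof -
      have "?q (U s) = w"
        using DG[OF that] linear_diff[OF bounded_linear.linear[OF q], of "U s" ?U0] by (simp add: w_def)
      then have 1: "((\<lambda>s. ?q (P s)) has_vector_derivative w) (at s within {0..})"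
        using bounded_linear.has_vector_derivative[OF q P[OF that]] by simp
      have 2: "((\<lambda>s. s *\<^sub>R w) has_vector_derivative w) (at s within {0..})"
        using bounded_linear.has_vector_derivative[OF bounded_linear_scaleR_left has_vector_derivative_id]
        by simp
      show ?thesis
        using has_vector_derivative_diff[OF 1 2] by simp
    qed
    then have "?q (P t) - t *\<^sub>R w = ?q (P 0) - 0 *\<^sub>R w"
      using that by (intro constant_if_has_vector_derivative_zero[of "\<lambda>s. ?q (P s) - s *\<^sub>R w"]) auto
    then show ?thesis
      by (simp add: P0 linear_0[OF bounded_linear.linear[OF q]])
  qed
  obtain K where K: "K > 0" "\<And>x. norm (?q x) \<le> norm x * K"
    using bounded_linear.pos_bounded[OF q] by blast
  have "w = 0"
  proof (rule ccontr)
    assume "w \<noteq> 0"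
    \<comment> \<open>At this time \<open>t * norm w\<close> equals \<open>sqrt E * K + 1\<close>,
      one more than the bound on \<open>P\<close> allows.\<close>
    define t where "t = (sqrt E * K + 1) / norm w"
    have "E \<ge> 0"
      by (simp add: E_def)
    with K have "t \<ge> 0"
      by (simp add: t_def)
    have "t * norm w \<le> norm (P t) * K"
      using K(2)[of "P t"] qP[OF \<open>t \<ge> 0\<close>] \<open>t \<ge> 0\<close> by simp
    also have "\<dots> \<le> sqrt E * K"
      using bound[OF \<open>t \<ge> 0\<close>] K(1) by simp
    finally show False
      using \<open>w \<noteq> 0\<close> by (simp add: t_def)
  qed
  then show ?thesis
    by (simp add: w_def mat_act_tensor componentwise_tensor ling)
qed

section \<open>Contraction over the \<real>^N index and exclusion of the conservative case\<close>

definition weighted_sum :: "real^'n \<Rightarrow> 'a::real_vector^'n \<Rightarrow> 'a" where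
  "weighted_sum f x = (\<Sum>i\<in>UNIV. f $ i *\<^sub>R x $ i)"

lemma bounded_linear_weighted_sum:
  "bounded_linear (weighted_sum f :: 'a::real_normed_vector^'n \<Rightarrow> 'a)"
  unfolding weighted_sum_def
  by (intro bounded_linear_sum bounded_linear_compose[OF bounded_linear_scaleR_right bounded_linear_vec_nth])

text \<open>Used twice: a weight in the range of the transpose of \<open>C\<close> sees only
  \<open>C U\<close>, and for symmetric \<open>A\<close> an eigenvector as weight turns the coupling
  into multiplication by its eigenvalue.\<close>

lemma weighted_sum_transpose: "weighted_sum (transpose C *v \<eta>) x = weighted_sum \<eta> (mat_act C x)"
proof -
  have "weighted_sum (transpose C *v \<eta>) x
      = (\<Sum>i\<in>UNIV. \<Sum>k\<in>UNIV. (\<eta> $ k * C $ k $ i) *\<^sub>R x $ i)"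
    by (simp add: weighted_sum_def matrix_vector_mult_def transpose_def scaleR_sum_left mult.commute)
  also have "\<dots> = (\<Sum>k\<in>UNIV. \<Sum>i\<in>UNIV. (\<eta> $ k * C $ k $ i) *\<^sub>R x $ i)"
    by (rule sum.swap)
  finally show ?thesis
    by (simp add: weighted_sum_def mat_act_def scaleR_sum_right)
qed

lemma weighted_sum_scaleR_left: "weighted_sum (r *\<^sub>R f) x = r *\<^sub>R weighted_sum f x"
  by (simp add: weighted_sum_def scaleR_sum_right)

lemma weighted_sum_componentwise:
  "linear k \<Longrightarrow> weighted_sum f (componentwise k x) = k (weighted_sum f x)"
  by (simp add: weighted_sum_def componentwise_def linear_sum linear_scale)

lemma weighted_sum_tensor: "weighted_sum f (tensor e u) = (f \<bullet> e) *\<^sub>R u"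
  by (simp add: weighted_sum_def tensor_def inner_vec_def scaleR_sum_left)

lemma tendsto_exp_neg_mult_at_top:
  assumes "\<omega> > 0"
  shows "((\<lambda>t::real. exp (- \<omega> * t)) \<longlongrightarrow> 0) at_top"
  by (rule filterlim_compose[OF exp_at_bot filterlim_tendsto_neg_mult_at_bot[OF tendsto_const]])
    (use assms in \<open>auto intro: filterlim_ident\<close>)

text \<open>For \<open>f = C\<^sup>T \<eta>\<close> with \<open>A f = \<mu> f\<close>, the component \<open>w = f \<bullet> U\<close> solves the conservative equation
  \<open>w'' + L w + \<mu> w = 0\<close>, while \<open>w = \<eta> \<bullet> C U\<close> decays by synchronization. Let \<open>p\<close> be the primitive
  of \<open>w\<close>. Then the energy \<open>|w|\<^sub>H\<^sup>2 + |p|\<^sub>V\<^sup>2 + \<mu> |p|\<^sub>H\<^sup>2\<close> is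
  conserved, and \<open>|p|\<^sub>V\<^sup>2 + \<mu> |p|\<^sub>H\<^sup>2 = - (w', p)\<^sub>H\<close> tends to zero.\<close>

lemma not_uniformly_synchronizable_undamped:
  fixes J :: "'v::{real_inner,complete_space} \<Rightarrow> 'h::{real_inner,complete_space}"
    and A D :: "real^'n^'n" and C :: "real^'n^'m"
  assumes nz: "\<exists>h::'h. h \<noteq> 0" and triple: "hilbert_triple J"
    and A: "symmetric_psd A" and "C \<noteq> 0" and CA: "Ker C \<subseteq> Ker (C ** A)" and g: "\<And>u. g u = 0"
  shows "\<not> uniformly_synchronizable J g A D C"
proof
  assume sync: "uniformly_synchronizable J g A D C"
  have J: "bounded_linear J"
    using triple by (auto simp: hilbert_triple_def dense_compact_embedding_def)
  note linJ = bounded_linear.linear[OF J] and linp = linear_pivot[OF J]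
  note linw = bounded_linear.linear[OF bounded_linear_weighted_sum]
  have symA: "transpose A = A"
    using A by (simp add: symmetric_psd_def)
  let ?S = "range ((*v) (transpose C))"
  obtain R where R: "C ** A = R ** C"
    by (rule Ker_subset_imp_factor[OF CA])
  \<comment> \<open>Transposing \<open>C ** A = R ** C\<close> and using the symmetry of
    \<open>A\<close> gives \<open>A ** transpose C = transpose C ** transpose R\<close>.\<close>
  have inv: "A *v x \<in> ?S" if x: "x \<in> ?S" for x
  proof -
    obtain \<eta> where "x = transpose C *v \<eta>"
      using x by blast
    then have "A *v x = transpose (C ** A) *v \<eta>"
      by (simp only: matrix_transpose_mul symA matrix_vector_mul_assoc)
    also have "\<dots> = transpose C *v (transpose R *v \<eta>)"
      by (simp only: R matrix_transpose_mul matrix_vector_mul_assoc)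
    finally show ?thesis
      by (simp only: rangeI)
  qed
  have "transpose C \<noteq> 0"
    using \<open>C \<noteq> 0\<close> by (auto simp: transpose_def vec_eq_iff)
  then obtain \<eta>\<^sub>0 where "transpose C *v \<eta>\<^sub>0 \<noteq> 0"
    using matrix_eq[of "transpose C" 0] by (auto simp del: transpose_matrix_vector)
  moreover have "subspace ?S"
    by (intro linear_subspace_image matrix_vector_mul_linear subspace_UNIV)
  ultimately obtain f \<mu> where "f \<in> ?S" "f \<noteq> 0" and Af: "A *v f = \<mu> *\<^sub>R f"
    using symmetric_matrix_has_eigenvector[OF symA, of ?S] inv by (metis rangeI)
  then obtain \<eta> where f: "f = transpose C *v \<eta>"
    by blast
  have "0 \<le> \<mu> * (f \<bullet> f)"
    using A Af unfolding symmetric_psd_def by (metis inner_scaleR_right)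
  moreover have "0 < f \<bullet> f"
    using \<open>f \<noteq> 0\<close> by simp
  ultimately have \<mu>: "\<mu> \<ge> 0"
    by (meson mult_neg_pos not_le)
  obtain v where v: "J v \<noteq> 0"
    using dense_compact_embedding_nonzero triple nz by (auto simp: hilbert_triple_def)
  \<comment> \<open>Contracting these data with \<open>f\<close> gives
    \<open>(f \<bullet> f) *\<^sub>R v\<close>, whose image under \<open>J\<close> is nonzero; the
    conserved energy is therefore positive.\<close>
  let ?U0 = "tensor f v"
  obtain M \<omega> where "\<omega> > 0" and "\<forall>U0 U1. \<exists>U U'. mild_solution J g A D U0 U1 U U' \<and>
      (\<forall>t\<ge>0. norm (mat_act C (U t), mat_act C (U' t))
        \<le> M * exp (- \<omega> * t) * norm (mat_act C U0, mat_act C U1))"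
    using sync unfolding uniformly_synchronizable_def by blast
  then obtain U U' where U: "mild_solution J g A D ?U0 0 U U'"
    and decay: "\<forall>t\<ge>0. norm (mat_act C (U t), mat_act C (U' t))
        \<le> M * exp (- \<omega> * t) * norm (mat_act C ?U0, mat_act C (0 :: 'h^'n))"
    by blast
  obtain P where P0: "P 0 = 0"
    and P: "\<And>t. t \<ge> 0 \<Longrightarrow> (P has_vector_derivative U t) (at t within {0..})"
    and eq: "\<And>t. t \<ge> 0 \<Longrightarrow> componentwise (pivot J) (U' t - 0) =
        - componentwise duality_map (P t)
        - componentwise (pivot J) (componentwise J (mat_act A (P t)))
        - mat_act D (componentwise g (U t - ?U0))"
    using mild_solution_primitive[OF U] by blast
  define p w w' where "p t = weighted_sum f (P t)" "w t = weighted_sum f (U t)"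
    "w' t = weighted_sum f (U' t)" for t
  note defs = this
  have p0: "p 0 = 0"
    by (simp add: defs P0 linear_0[OF linw])
  have eq_w: "w' t \<bullet> J \<phi> + (p t \<bullet> \<phi> + (\<mu> *\<^sub>R J (p t)) \<bullet> J \<phi>) = 0" if "t \<ge> 0" for t \<phi>
  proof -
    have "mat_act D (componentwise g (U t - ?U0)) = 0"
      by (simp add: mat_act_def componentwise_def g vec_eq_iff)
    moreover have "weighted_sum f (mat_act A (P t)) = \<mu> *\<^sub>R p t"
      using weighted_sum_transpose[of A f "P t"]
      by (simp only: symA Af weighted_sum_scaleR_left defs)
    ultimately have "pivot J (w' t) = - duality_map (p t) - pivot J (J (\<mu> *\<^sub>R p t))"
      using arg_cong[OF eq[OF that], of "weighted_sum f"]
      by (simp add: linear_diff[OF linw] linear_neg[OF linw] weighted_sum_componentwise linJ linp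
          linear_duality_map defs)
    from arg_cong[OF this, of "\<lambda>F. blinfun_apply F \<phi>"] show ?thesis
      by (simp add: pivot_apply[OF J] blinfun.bilinear_simps linear_scale[OF linJ])
  qed
  let ?B = "\<lambda>x y. x \<bullet> y + (\<mu> *\<^sub>R J x) \<bullet> J y"
  define E where "E = J v \<bullet> J v * (f \<bullet> f)\<^sup>2"
  have energy: "J (w t) \<bullet> J (w t) + ?B (p t) (p t) = E" if "t \<ge> 0" for t
  proof -
    have "J (w t) \<bullet> J (w t) + ?B (p t) (p t) = J (w 0) \<bullet> J (w 0) + ?B (p 0) (p 0)"
    proof (rule energy_conservation[where U' = w' and B = ?B])
      show "bounded_bilinear ?B"
        by (intro bounded_bilinear_inner_add_inner J
            bounded_linear_compose[OF bounded_linear_scaleR_right J])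
      show "?B x y = ?B y x" for x y
        by (simp add: inner_commute)
      show "(p has_vector_derivative w t) (at t within {0..})" if "t \<ge> 0" for t
        unfolding defs
        by (rule bounded_linear.has_vector_derivative[OF bounded_linear_weighted_sum P[OF that]])
      show "((\<lambda>s. J (w s)) has_vector_derivative w' t) (at t within {0..})" if "t \<ge> 0" for t
      proof -
        have "((\<lambda>s. componentwise J (U s)) has_vector_derivative U' t) (at t within {0..})"
          using U that by (simp add: mild_solution_def)
        from bounded_linear.has_vector_derivative[OF bounded_linear_weighted_sum this, of f]
        show ?thesis
          by (simp add: defs weighted_sum_componentwise linJ)
      qed
    qed (use eq_w that in auto)
    moreover have "U 0 = ?U0"
      using U by (auto simp: mild_solution_def c0_semigroup_def)
    ultimately show ?thesis
      by (simp add: p0 defs(2) weighted_sum_tensor linear_0[OF linJ] linear_scale[OF linJ] E_def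
          power2_eq_square)
  qed
  obtain K where K: "\<And>x. norm (J x) \<le> norm x * K" "K > 0"
    using bounded_linear.pos_bounded[OF J] by blast
  have Jp: "norm (J (p t)) \<le> sqrt E * K" if "t \<ge> 0" for t
  proof -
    have "0 \<le> J (w t) \<bullet> J (w t)" "0 \<le> (\<mu> *\<^sub>R J (p t)) \<bullet> J (p t)"
      using \<mu> by simp_all
    then have "p t \<bullet> p t \<le> E"
      using energy[OF that] by linarith
    then have "norm (p t) \<le> sqrt E"
      by (simp add: norm_eq_sqrt_inner)
    then have "norm (p t) * K \<le> sqrt E * K"
      using K(2) by simp
    with K(1)[of "p t"] show ?thesis
      by linarith
  qed
  \<comment> \<open>With \<open>\<phi> = p t\<close> the equation expresses the potential energy as
    \<open>- (w' t \<bullet> J (p t))\<close>. As \<open>J (p t)\<close> stays bounded,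
    \<open>E\<close> is controlled by the decaying \<open>w\<close> and \<open>w'\<close>.\<close>
  have upper: "E \<le> (norm (w t) * K)\<^sup>2 + norm (w' t) * (sqrt E * K)" if "t \<ge> 0" for t
  proof -
    have "?B (p t) (p t) \<le> norm (w' t) * norm (J (p t))"
      using eq_w[OF that, of "p t"] Cauchy_Schwarz_ineq2[of "w' t" "J (p t)"] by linarith
    also have "\<dots> \<le> norm (w' t) * (sqrt E * K)"
      by (intro mult_left_mono Jp that) simp
    finally have "?B (p t) (p t) \<le> norm (w' t) * (sqrt E * K)" .
    moreover have "J (w t) \<bullet> J (w t) \<le> (norm (w t) * K)\<^sup>2"
      unfolding power2_norm_eq_inner[symmetric] by (intro power_mono K(1)) simp
    ultimately show ?thesis
      using energy[OF that] by linarith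
  qed
  have CU: "((\<lambda>t. (mat_act C (U t), mat_act C (U' t))) \<longlongrightarrow> 0) at_top"
  proof (rule Lim_null_comparison)
    show "\<forall>\<^sub>F t in at_top. norm (mat_act C (U t), mat_act C (U' t))
        \<le> M * exp (- \<omega> * t) * norm (mat_act C ?U0, mat_act C (0 :: 'h^'n))"
      by (rule eventually_at_top_linorderI[of 0]) (use decay in blast)
    have "((\<lambda>t. M * exp (- \<omega> * t) * norm (mat_act C ?U0, mat_act C (0 :: 'h^'n)))
        \<longlongrightarrow> M * 0 * norm (mat_act C ?U0, mat_act C (0 :: 'h^'n))) at_top"
      by (intro tendsto_mult tendsto_const tendsto_exp_neg_mult_at_top \<open>\<omega> > 0\<close>)
    then show "((\<lambda>t. M * exp (- \<omega> * t) * norm (mat_act C ?U0, mat_act C (0 :: 'h^'n)))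
        \<longlongrightarrow> 0) at_top"
      by simp
  qed
  \<comment> \<open>Since \<open>f\<close> lies in the range of the transpose of \<open>C\<close>,
    both components are contractions of the synchronization errors.\<close>
  have w_eq: "w = (\<lambda>t. weighted_sum \<eta> (mat_act C (U t)))"
    "w' = (\<lambda>t. weighted_sum \<eta> (mat_act C (U' t)))"
    by (rule ext, simp only: defs f weighted_sum_transpose)+
  have "(w \<longlongrightarrow> 0) at_top" "(w' \<longlongrightarrow> 0) at_top"
    using bounded_linear.tendsto[OF bounded_linear_weighted_sum[of \<eta>] tendsto_fst[OF CU]]
      bounded_linear.tendsto[OF bounded_linear_weighted_sum[of \<eta>] tendsto_snd[OF CU]]
    unfolding w_eq by (simp_all add: linear_0[OF linw])
  then have "((\<lambda>t. (norm (w t) * K)\<^sup>2 + norm (w' t) * (sqrt E * K))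
      \<longlongrightarrow> (norm (0::'v) * K)\<^sup>2 + norm (0::'h) * (sqrt E * K)) at_top"
    by (intro tendsto_intros)
  moreover have "\<forall>\<^sub>F t in at_top. E \<le> (norm (w t) * K)\<^sup>2 + norm (w' t) * (sqrt E * K)"
    by (rule eventually_at_top_linorderI[of 0]) (rule upper)
  ultimately have "E \<le> (norm (0::'v) * K)\<^sup>2 + norm (0::'h) * (sqrt E * K)"
    by (rule tendsto_lowerbound) simp
  moreover have "E > 0"
    using v \<open>f \<noteq> 0\<close> by (simp add: E_def)
  ultimately show False
    by simp
qed

theorem theorem3p7:
  fixes J :: "'v::{real_inner,complete_space} \<Rightarrow> 'h::{real_inner,complete_space}"
    and g :: "'v \<Rightarrow> ('v \<Rightarrow>\<^sub>L real)"
    and A D :: "real^('n::{finite,linorder})^('n::{finite,linorder})"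
    and C :: "real^('n::{finite,linorder})^('m::{finite,linorder})"
    and n :: "nat \<Rightarrow> nat" and p :: nat
  assumes "\<exists>h::'h. h \<noteq> 0"
    and "hilbert_triple J"
    and "symmetric_nonneg_operator g"
    and "p \<ge> 1" and "grouping n p CARD('n)"
    and "CARD('m) = CARD('n) - p" and "C = sync_matrix n p"
    and "symmetric_psd A" and "symmetric_psd D"
    and "uniformly_synchronizable J g A D C"
    and "rank D = CARD('n) - p" and "rank (C ** D) = CARD('n) - p"
  shows "(\<lambda>x. A *v x) ` Ker C \<subseteq> Ker C \<and> Ker C \<subseteq> Ker D"
proof -
  have J: "bounded_linear J"
    using assms(2) by (auto simp: hilbert_triple_def dense_compact_embedding_def)
  have CA: "Ker C \<subseteq> Ker (C ** A)"
    by (rule uniformly_synchronizable_imp_compatible) fact+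
  have CD: "Ker (C ** D) \<subseteq> Ker D"
    using assms(11,12) by (intro Ker_mult_subset_if_rank_eq) simp
  \<comment> \<open>Index types are nonempty, so the common rank \<open>N - p\<close> is positive,
    which forces \<open>C \<noteq> 0\<close>.\<close>
  have "0 < CARD('m)"
    by simp
  then have "rank (C ** D) \<noteq> 0"
    using assms(6,12) by simp
  then have "C \<noteq> 0"
    by (auto simp: rank_eq_0)
  \<comment> \<open>With \<open>g u \<noteq> 0\<close>, the vanishing of
    \<open>D e \<otimes> g u\<close> leaves only \<open>D e = 0\<close>.\<close>
  then obtain u where u: "g u \<noteq> 0"
    using not_uniformly_synchronizable_undamped[OF assms(1,2,8) _ CA] assms(10) by blast
  have "D *v e = 0" if "e \<in> Ker C" for e
    using uniformly_synchronizable_damping_on_Ker[OF J assms(3,8,10) CA CD that, of u] u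
    by (simp add: tensor_eq_0_iff)
  then show ?thesis
    using CA by (auto simp: Ker_def matrix_vector_mul_assoc)
qed

end
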